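(* Let $G$ be a connected co-biconvex graph with at least two vertices, let $U$ be its set of universal vertices, and let $\alpha_1,\alpha_2$ be the independence numbers of the auxiliary interval graphs $H_1,H_2$ of $G-U$ described in the context. Then: (i) if $|U|=1$ then $\gamma_{\times 2}(G)=3$; (ii) if $|U|\geq 2$ then $\gamma_{\times 2}(G)=2$; (iii) if $|U|=0$ and $\alpha_1+\alpha_2\geq 3$ then $\gamma_{\times 2}(G)=3$; (iv) if $|U|=0$ and $\alpha_1=\alpha_2=1$ then $\gamma_{\times 2}(G)=4$.
   Context: For a graph $G$ with vertices $v_1,\dots,v_n$, $M^*(G)$ is the $0,1$-matrix with entry $(i,j)=1$ iff $i=j$ or $v_iv_j\in E(G)$. $G$ is co-biconvex if the rows of $M^*(G)$ can be permuted so the 0's in every column are consecutive. A vertex is universal if adjacent to all others; $U$ denotes the set of universal vertices, and $G-U$ is again co-biconvex without universal vertices. For a co-biconvex graph $G'$ without universal vertices: fix an ordering $v_1,\dots,v_n$ (rows and columns of $M^*(G')$ in this order) in which the 0's of each column are consecutive; $C_1$ is the set of vertices whose column has its 0's below the diagonal and $C_2$ those whose column has its 0's above; they partition $V(G')$, are cliques, and we may take $C_1=\{v_1,\dots,v_r\}$, $C_2=\{v_{r+1},\dots,v_n\}$. For $v_i\in C_1$ (resp. $C_2$), if the 0's of column $i$ occupy rows $p,\dots,p+s$ (all in $C_2$, resp. all in $C_1$), set $I_i=[p,p+s]$. $H_1$ is the intersection graph of $\{I_i:v_i\in C_1\}$ and $H_2$ of $\{I_i: v_i\in C_2\}$; equivalently,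 two vertices of $C_1$ are adjacent in $H_1$ iff some vertex of $C_2$ is non-adjacent to both (symmetrically for $H_2$). $N_G[v]$ is the closed neighborhood; $D$ is a $k$-tuple dominating set if $|N_G[v]\cap D|\ge k$ for all $v$; $\gamma_{\times k}(G)$ is the minimum size of such a set. *)

theory Defs
  imports
    "HOL-Combinatorics.Permutations"
    "Jordan_Normal_Form.Matrix"
    "Graph_Theory.Digraph_Component"
    "Graph_Theory.Pair_Digraph"
begin

text \<open>
  Finite simple graphs are rendered by the locale \<open>graph\<close> of \<open>Graph_Theory\<close>, that is, as
  finite symmetric digraphs without loops and parallel arcs; \<open>u \<rightarrow>\<^bsub>G\<^esub> v\<close> is adjacency.
\<close>

subsection \<open>Universal vertices and domination\<close>

definition universal_vertices :: "('a, 'b) pre_digraph \<Rightarrow> 'a set" where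
  "universal_vertices G = {v \<in> verts G. \<forall>w \<in> verts G. w \<noteq> v \<longrightarrow> v \<rightarrow>\<^bsub>G\<^esub> w}"

definition closed_nbhd :: "('a, 'b) pre_digraph \<Rightarrow> 'a \<Rightarrow> 'a set" where
  "closed_nbhd G v = insert v {w \<in> verts G. v \<rightarrow>\<^bsub>G\<^esub> w}"

definition tuple_dominating :: "nat \<Rightarrow> ('a, 'b) pre_digraph \<Rightarrow> 'a set \<Rightarrow> bool" where
  "tuple_dominating k G D \<longleftrightarrow>
     D \<subseteq> verts G \<and> (\<forall>v \<in> verts G. k \<le> card (closed_nbhd G v \<inter> D))"

text \<open>
  The minimum is over a nonempty set only if \<open>verts G\<close> itself is \<open>k\<close>-tuple dominating
  (for \<open>k = 2\<close>: no isolated vertices); otherwise the value is unspecified.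
\<close>
definition tuple_domination_number :: "nat \<Rightarrow> ('a, 'b) pre_digraph \<Rightarrow> nat" where
  "tuple_domination_number k G = Min (card ` {D. tuple_dominating k G D})"

subsection \<open>Independence number and intersection graphs\<close>

definition independent_in :: "('a, 'b) pre_digraph \<Rightarrow> 'a set \<Rightarrow> bool" where
  "independent_in H S \<longleftrightarrow> S \<subseteq> verts H \<and> (\<forall>u \<in> S. \<forall>v \<in> S. \<not> u \<rightarrow>\<^bsub>H\<^esub> v)"

definition independence_number :: "('a, 'b) pre_digraph \<Rightarrow> nat" where
  "independence_number H = Max (card ` {S. independent_in H S})"

definition intersection_graph :: "'i set \<Rightarrow> ('i \<Rightarrow> 's set) \<Rightarrow> 'i pair_pre_digraph" where
  "intersection_graph J I =
     \<lparr> pverts = J, parcs = {(i, j). i \<in> J \<and> j \<in> J \<and> i \<noteq> j \<and> I i \<inter> I j \<noteq> {}} \<rparr>"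

subsection \<open>The augmented adjacency matrix and co-biconvex graphs\<close>

text \<open>
  A list \<open>vs\<close> enumerates the vertices; positions are counted from 0, so the vertex
  called $v_{i+1}$ on paper is \<open>vs ! i\<close>.
\<close>
definition vertex_enum :: "('a, 'b) pre_digraph \<Rightarrow> 'a list \<Rightarrow> bool" where
  "vertex_enum G vs \<longleftrightarrow> distinct vs \<and> set vs = verts G"

definition M_star :: "('a, 'b) pre_digraph \<Rightarrow> 'a list \<Rightarrow> nat mat" where
  "M_star G vs = mat (length vs) (length vs)
     (\<lambda>(i, j). if i = j \<or> vs ! i \<rightarrow>\<^bsub>G\<^esub> vs ! j then 1 else 0)"

definition zero_rows :: "nat mat \<Rightarrow> nat \<Rightarrow> nat set" where
  "zero_rows A j = {i. i < dim_row A \<and> A $$ (i, j) = 0}"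

text \<open>A column without 0's is allowed (take \<open>p = q\<close>).\<close>
definition consecutive_zeros :: "nat mat \<Rightarrow> bool" where
  "consecutive_zeros A \<longleftrightarrow> (\<forall>j < dim_col A. \<exists>p q. zero_rows A j = {p..<q})"

definition permute_rows :: "(nat \<Rightarrow> nat) \<Rightarrow> 'c mat \<Rightarrow> 'c mat" where
  "permute_rows \<pi> A = mat (dim_row A) (dim_col A) (\<lambda>(i, j). A $$ (\<pi> i, j))"

definition co_biconvex :: "('a, 'b) pre_digraph \<Rightarrow> bool" where
  "co_biconvex G \<longleftrightarrow>
     (\<exists>vs \<pi>. vertex_enum G vs \<and> \<pi> permutes {..<length vs} \<and>
             consecutive_zeros (permute_rows \<pi> (M_star G vs)))"

subsection \<open>The auxiliary interval graphs\<close>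

text \<open>
  From here on \<open>G\<close> is meant to have no universal vertices, so that every column contains a 0,
  and vertices are represented by their positions in \<open>vs\<close>. As the diagonal entries are 1,
  consecutive 0's of a column lie all below or all above the diagonal.
\<close>
definition C1 :: "('a, 'b) pre_digraph \<Rightarrow> 'a list \<Rightarrow> nat set" where
  "C1 G vs = {j. j < length vs \<and> (\<forall>i \<in> zero_rows (M_star G vs) j. j < i)}"

definition C2 :: "('a, 'b) pre_digraph \<Rightarrow> 'a list \<Rightarrow> nat set" where
  "C2 G vs = {j. j < length vs \<and> (\<forall>i \<in> zero_rows (M_star G vs) j. i < j)}"

definition clique_ordering :: "('a, 'b) pre_digraph \<Rightarrow> 'a list \<Rightarrow> bool" where
  "clique_ordering G vs \<longleftrightarrow>
     vertex_enum G vs \<and> consecutive_zeros (M_star G vs) \<and>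
     (\<exists>r \<le> length vs. C1 G vs = {..<r} \<and> C2 G vs = {r..<length vs})"

definition zero_interval :: "('a, 'b) pre_digraph \<Rightarrow> 'a list \<Rightarrow> nat \<Rightarrow> real set" where
  "zero_interval G vs j =
     {real (Min (zero_rows (M_star G vs) j)) .. real (Max (zero_rows (M_star G vs) j))}"

definition H1 :: "('a, 'b) pre_digraph \<Rightarrow> 'a list \<Rightarrow> nat pair_pre_digraph" where
  "H1 G vs = intersection_graph (C1 G vs) (zero_interval G vs)"

definition H2 :: "('a, 'b) pre_digraph \<Rightarrow> 'a list \<Rightarrow> nat pair_pre_digraph" where
  "H2 G vs = intersection_graph (C2 G vs) (zero_interval G vs)"

subsection \<open>Existence of the orderings\<close>

lemma consecutive_iff_split:
  "(\<exists>p q. {i. i < length vs \<and> vs ! i \<in> N} = {p..<q}) \<longleftrightarrow>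
   (\<exists>xs ys zs. vs = xs @ ys @ zs \<and> set xs \<inter> N = {} \<and> set ys \<subseteq> N \<and> set zs \<inter> N = {})"
  (is "?L \<longleftrightarrow> ?R")
proof
  assume ?L
  then obtain p q where pq: "{i. i < length vs \<and> vs ! i \<in> N} = {p..<q}" by blast
  show ?R
  proof (cases "p < q")
    case False
    then have "\<not> (i < length vs \<and> vs ! i \<in> N)" for i using pq by auto
    then have "set vs \<inter> N = {}" unfolding in_set_conv_nth disjoint_iff by blast
    then have "vs = vs @ [] @ [] \<and> set vs \<inter> N = {} \<and> set [] \<subseteq> N \<and> set [] \<inter> N = {}" by simp
    then show ?thesis by blast
  next
    case True
    have in_iff: "i < length vs \<Longrightarrow> vs ! i \<in> N \<longleftrightarrow> p \<le> i \<and> i < q" for i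
      using pq by (auto simp: set_eq_iff)
    have q: "q \<le> length vs"
    proof -
      have "q - 1 \<in> {i. i < length vs \<and> vs ! i \<in> N}" unfolding pq using True by auto
      then show ?thesis by auto
    qed
    have dq: "drop (q - p) (drop p vs) = drop q vs" using True by simp
    have split: "vs = take p vs @ take (q - p) (drop p vs) @ drop q vs"
      unfolding dq[symmetric] append_take_drop_id by (rule refl)
    have "set (take p vs) \<inter> N = {}"
    proof -
      have "x \<notin> N" if "x \<in> set (take p vs)" for x
      proof -
        obtain i where "i < p" "i < length vs" "x = vs ! i"
          using \<open>x \<in> set (take p vs)\<close> by (auto simp: in_set_conv_nth)
        then show ?thesis using in_iff[of i] by simp
      qed
      then show ?thesis by blast
    qed
    moreover have "set (take (q - p) (drop p vs)) \<subseteq> N"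
    proof
      fix x assume "x \<in> set (take (q - p) (drop p vs))"
      then obtain i where "i < q - p" "x = vs ! (p + i)"
        using q by (auto simp: in_set_conv_nth)
      then show "x \<in> N" using in_iff[of "p + i"] q by simp
    qed
    moreover have "set (drop q vs) \<inter> N = {}"
    proof -
      have "x \<notin> N" if "x \<in> set (drop q vs)" for x
      proof -
        obtain i where "i < length vs - q" "x = vs ! (q + i)"
          using \<open>x \<in> set (drop q vs)\<close> q by (auto simp: in_set_conv_nth)
        then show ?thesis using in_iff[of "q + i"] by simp
      qed
      then show ?thesis by blast
    qed
    ultimately show ?thesis using split by blast
  qed
next
  assume ?R
  then obtain xs ys zs where s: "vs = xs @ ys @ zs" "set xs \<inter> N = {}" "set ys \<subseteq> N" "set zs \<inter> N = {}"
    by blast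
  have "(i < length vs \<and> vs ! i \<in> N) \<longleftrightarrow> (length xs \<le> i \<and> i < length xs + length ys)" for i
  proof -
    consider "i < length xs" | "length xs \<le> i" "i < length xs + length ys"
      | "length xs + length ys \<le> i" "i < length vs" | "length vs \<le> i"
      by linarith
    then show ?thesis
    proof cases
      case 1
      then have "vs ! i = xs ! i" using s(1) by (simp add: nth_append)
      moreover have "xs ! i \<notin> N" using s(2) nth_mem[OF 1] by blast
      ultimately show ?thesis using 1 by simp
    next
      case 2
      then have "vs ! i = ys ! (i - length xs)" "i - length xs < length ys"
        using s(1) by (auto simp: nth_append)
      moreover have "ys ! (i - length xs) \<in> N" using s(3) nth_mem[OF calculation(2)] by blast
      ultimately show ?thesis using 2 s(1) by simp
    next
      case 3
      then have "vs ! i = zs ! (i - length xs - length ys)" "i - length xs - length ys < length zs"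
        using s(1) by (auto simp: nth_append)
      moreover have "zs ! (i - length xs - length ys) \<notin> N"
        using s(4) nth_mem[OF calculation(2)] by blast
      ultimately show ?thesis using 3 by simp
    next
      case 4 then show ?thesis using s(1) by auto
    qed
  qed
  then have "{i. i < length vs \<and> vs ! i \<in> N} = {length xs..<length xs + length ys}"
    unfolding set_eq_iff mem_Collect_eq atLeastLessThan_iff by blast
  then show ?L by blast
qed

definition non_nbhd :: "('a, 'b) pre_digraph \<Rightarrow> 'a \<Rightarrow> 'a set" where
  "non_nbhd G v = {w. w \<noteq> v \<and> \<not> w \<rightarrow>\<^bsub>G\<^esub> v}"

lemma zero_rows_M_star:
  assumes "distinct vs" "j < length vs"
  shows "zero_rows (M_star G vs) j = {i. i < length vs \<and> vs ! i \<in> non_nbhd G (vs ! j)}"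
proof -
  have "i \<in> zero_rows (M_star G vs) j \<longleftrightarrow> i < length vs \<and> vs ! i \<in> non_nbhd G (vs ! j)" for i
    using assms nth_eq_iff_index_eq[OF assms(1), of i j]
    by (cases "i < length vs") (simp_all add: zero_rows_def M_star_def non_nbhd_def)
  then show ?thesis by blast
qed

lemma dim_col_M_star: "dim_col (M_star G vs) = length vs"
  by (simp add: M_star_def)

lemma consecutive_zeros_M_star:
  assumes "distinct vs"
  shows "consecutive_zeros (M_star G vs) \<longleftrightarrow>
    (\<forall>v \<in> set vs. \<exists>xs ys zs. vs = xs @ ys @ zs \<and> set xs \<inter> non_nbhd G v = {} \<and>
       set ys \<subseteq> non_nbhd G v \<and> set zs \<inter> non_nbhd G v = {})"
proof -
  have "consecutive_zeros (M_star G vs) \<longleftrightarrow>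
    (\<forall>j < length vs. \<exists>p q. {i. i < length vs \<and> vs ! i \<in> non_nbhd G (vs ! j)} = {p..<q})"
    using assms unfolding consecutive_zeros_def
    by (simp add: zero_rows_M_star dim_col_M_star)
  then show ?thesis unfolding consecutive_iff_split all_set_conv_all_nth .
qed

lemma co_biconvex_iff:
  "co_biconvex G \<longleftrightarrow> (\<exists>vs. vertex_enum G vs \<and> consecutive_zeros (M_star G vs))"
proof
  assume "co_biconvex G"
  then obtain vs \<pi> where vs: "vertex_enum G vs" and p: "\<pi> permutes {..<length vs}"
    and c: "consecutive_zeros (permute_rows \<pi> (M_star G vs))"
    unfolding co_biconvex_def by blast
  define n where "n = length vs"
  define ws where "ws = map (\<lambda>i. vs ! \<pi> i) [0..<n]"
  have im: "\<pi> ` {..<n} = {..<n}" using p by (simp add: permutes_image n_def)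
  have lt: "i < n \<Longrightarrow> \<pi> i < n" for i using im by blast
  have inj: "inj_on \<pi> {..<n}" using p permutes_inj_on by blast
  have d: "distinct vs" and sv: "set vs = verts G" using vs by (auto simp: vertex_enum_def)
  have dw: "distinct ws" unfolding ws_def distinct_map
    using d lt inj by (auto simp: inj_on_def nth_eq_iff_index_eq n_def)
  have sw: "set ws = set vs"
  proof -
    have "set ws = (\<lambda>i. vs ! i) ` (\<pi> ` {..<n})" unfolding ws_def by (auto simp: lessThan_atLeast0)
    also have "\<dots> = set vs" unfolding im by (auto simp: n_def in_set_conv_nth)
    finally show ?thesis .
  qed
  have lw: "length ws = n" by (simp add: ws_def)
  have "\<exists>p q. {i. i < length ws \<and> ws ! i \<in> non_nbhd G v} = {p..<q}" if v: "v \<in> set vs" for v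
  proof -
    obtain j where j: "j < n" "v = vs ! j" using v unfolding in_set_conv_nth n_def by blast
    have "zero_rows (permute_rows \<pi> (M_star G vs)) j =
        {i. i < n \<and> vs ! \<pi> i \<in> non_nbhd G (vs ! j)}"
    proof -
      have "i \<in> zero_rows (permute_rows \<pi> (M_star G vs)) j \<longleftrightarrow>
          i < n \<and> vs ! \<pi> i \<in> non_nbhd G (vs ! j)" for i
      proof (cases "i < n")
        case True
        then have "vs ! \<pi> i = vs ! j \<longleftrightarrow> \<pi> i = j"
          using nth_eq_iff_index_eq[OF d, of "\<pi> i" j] lt[OF True] j(1) by (simp add: n_def)
        then show ?thesis using True lt[OF True] j(1)
          by (simp add: zero_rows_def permute_rows_def M_star_def non_nbhd_def n_def)
      qed (simp add: zero_rows_def permute_rows_def M_star_def n_def)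
      then show ?thesis by blast
    qed
    also have "\<dots> = {i. i < length ws \<and> ws ! i \<in> non_nbhd G v}"
      using j by (auto simp: ws_def)
    finally have eq: "zero_rows (permute_rows \<pi> (M_star G vs)) j =
        {i. i < length ws \<and> ws ! i \<in> non_nbhd G v}" .
    have "j < dim_col (permute_rows \<pi> (M_star G vs))"
      using j(1) by (simp add: permute_rows_def dim_col_M_star n_def)
    then show ?thesis using c unfolding consecutive_zeros_def eq[symmetric] by blast
  qed
  then have "consecutive_zeros (M_star G ws)"
    unfolding consecutive_zeros_M_star[OF dw] consecutive_iff_split sw by blast
  then show "\<exists>vs. vertex_enum G vs \<and> consecutive_zeros (M_star G vs)"
    using dw sw sv by (auto simp: vertex_enum_def)
next
  assume "\<exists>vs. vertex_enum G vs \<and> consecutive_zeros (M_star G vs)"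
  then obtain vs where vs: "vertex_enum G vs" "consecutive_zeros (M_star G vs)" by blast
  have "permute_rows id (M_star G vs) = M_star G vs"
    by (rule eq_matI) (auto simp: permute_rows_def)
  then show "co_biconvex G" unfolding co_biconvex_def
    by (intro exI[of _ vs] exI[of _ id]) (simp add: vs permutes_id)
qed

lemma dominates_induce_iff:
  "u \<in> S \<Longrightarrow> v \<in> S \<Longrightarrow> u \<rightarrow>\<^bsub>G \<restriction> S\<^esub> v \<longleftrightarrow> u \<rightarrow>\<^bsub>G\<^esub> v"
  by (auto simp: arcs_ends_conv)

lemma co_biconvex_induce:
  assumes "co_biconvex G"
  shows "co_biconvex (G \<restriction> (verts G - X))"
proof -
  let ?S = "verts G - X"
  obtain vs where d: "distinct vs" and sv: "set vs = verts G"
    and c: "consecutive_zeros (M_star G vs)"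
    using assms by (auto simp: co_biconvex_iff vertex_enum_def)
  let ?f = "filter (\<lambda>x. x \<in> ?S)"
  have dw: "distinct (?f vs)" and sw: "set (?f vs) = ?S" using d sv by auto
  have "\<exists>xs ys zs. ?f vs = xs @ ys @ zs \<and> set xs \<inter> non_nbhd (G \<restriction> ?S) v = {} \<and>
       set ys \<subseteq> non_nbhd (G \<restriction> ?S) v \<and> set zs \<inter> non_nbhd (G \<restriction> ?S) v = {}"
    if v: "v \<in> ?S" for v
  proof -
    have vv: "v \<in> set vs" using v sv by simp
    obtain xs ys zs where s: "vs = xs @ ys @ zs" "set xs \<inter> non_nbhd G v = {}"
      "set ys \<subseteq> non_nbhd G v" "set zs \<inter> non_nbhd G v = {}"
      using c vv unfolding consecutive_zeros_M_star[OF d] by blast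
    have "w \<in> non_nbhd (G \<restriction> ?S) v \<longleftrightarrow> w \<in> non_nbhd G v" if "w \<in> ?S" for w
      using v that by (auto simp: non_nbhd_def dominates_induce_iff)
    then have N: "set (?f us) \<inter> non_nbhd (G \<restriction> ?S) v = set (?f us) \<inter> non_nbhd G v" for us
      by auto
    have "?f vs = ?f xs @ ?f ys @ ?f zs" unfolding s(1) by simp
    moreover have "set (?f xs) \<inter> non_nbhd (G \<restriction> ?S) v = {}" "set (?f zs) \<inter> non_nbhd (G \<restriction> ?S) v = {}"
      unfolding N using s(2,4) by auto
    moreover have "set (?f ys) \<subseteq> non_nbhd (G \<restriction> ?S) v" using N[of ys] s(3) by auto
    ultimately show ?thesis by blast
  qed
  then have "consecutive_zeros (M_star (G \<restriction> ?S) (?f vs))"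
    unfolding consecutive_zeros_M_star[OF dw] sw by blast
  then show ?thesis unfolding co_biconvex_iff vertex_enum_def using dw sw by auto
qed

lemma universal_vertices_induce:
  assumes "graph G"
  shows "universal_vertices (G \<restriction> (verts G - universal_vertices G)) = {}"
proof -
  interpret graph G by fact
  let ?S = "verts G - universal_vertices G"
  have "v \<in> universal_vertices G" if v: "v \<in> ?S" and u: "\<forall>w\<in>?S. w \<noteq> v \<longrightarrow> v \<rightarrow>\<^bsub>G\<^esub> w" for v
  proof -
    have "v \<rightarrow>\<^bsub>G\<^esub> w" if "w \<in> verts G" "w \<noteq> v" for w
    proof (cases "w \<in> ?S")
      case True then show ?thesis using u that by blast
    next
      case False
      then have "w \<rightarrow>\<^bsub>G\<^esub> v" using that v by (auto simp: universal_vertices_def)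
      then show ?thesis using sym_arcs by (auto simp: symmetric_def dest: symD)
    qed
    then show ?thesis using v by (auto simp: universal_vertices_def)
  qed
  note univ = this
  show ?thesis
  proof (rule equals0I)
    fix v assume v: "v \<in> universal_vertices (G \<restriction> ?S)"
    then have vS: "v \<in> ?S" and "\<forall>w\<in>?S. w \<noteq> v \<longrightarrow> v \<rightarrow>\<^bsub>G \<restriction> ?S\<^esub> w"
      unfolding universal_vertices_def[of "G \<restriction> ?S"] induce_subgraph_verts by blast+
    then have "\<forall>w\<in>?S. w \<noteq> v \<longrightarrow> v \<rightarrow>\<^bsub>G\<^esub> w" using dominates_induce_iff[OF vS] by blast
    then show False using univ[OF vS] vS by blast
  qed
qed

lemma ex_clique_ordering:
  assumes sym: "symmetric G" and nu: "universal_vertices G = {}" and cb: "co_biconvex G"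
  shows "\<exists>vs. clique_ordering G vs"
proof -
  obtain vs where d: "distinct vs" and sv: "set vs = verts G"
    and c: "consecutive_zeros (M_star G vs)"
    using cb by (auto simp: co_biconvex_iff vertex_enum_def)
  let ?N = "non_nbhd G"
  have Nsym: "w \<in> ?N v \<longleftrightarrow> v \<in> ?N w" for v w
    using sym by (auto simp: non_nbhd_def symmetric_def dest: symD)
  have Nne: "\<exists>w \<in> set vs. w \<in> ?N v" if "v \<in> set vs" for v
  proof -
    have "v \<notin> universal_vertices G" "v \<in> verts G" using nu that sv by auto
    then obtain w where "w \<in> verts G" "w \<noteq> v" "\<not> v \<rightarrow>\<^bsub>G\<^esub> w"
      unfolding universal_vertices_def by blast
    moreover have "\<not> w \<rightarrow>\<^bsub>G\<^esub> v"
      using sym calculation(3) unfolding symmetric_def by (meson symD)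
    ultimately show ?thesis using sv by (auto simp: non_nbhd_def)
  qed
  define A where "A = {vs ! j | j. j \<in> C1 G vs}"
  have A_nth: "vs ! j \<in> A \<longleftrightarrow> j \<in> C1 G vs" if "j < length vs" for j
    using that d by (auto simp: A_def C1_def nth_eq_iff_index_eq)
  have zr: "i \<in> zero_rows (M_star G vs) j \<longleftrightarrow> vs ! i \<in> ?N (vs ! j)"
    if "i < length vs" "j < length vs" for i j
    using that d by (auto simp: zero_rows_M_star)
  have below: "j < i" if "j \<in> C1 G vs" "i < length vs" "vs ! i \<in> ?N (vs ! j)" for i j
    using that zr[of i j] by (auto simp: C1_def)
  have above: "i < j" if j: "j < length vs" "j \<notin> C1 G vs" and i: "i < length vs" "vs ! i \<in> ?N (vs ! j)" for i j
  proof (rule ccontr)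
    assume "\<not> i < j"
    obtain k where k: "k \<in> zero_rows (M_star G vs) j" "k \<le> j" using j by (auto simp: C1_def not_less)
    have "i \<in> zero_rows (M_star G vs) j" using zr i j by blast
    moreover obtain p q where "zero_rows (M_star G vs) j = {p..<q}"
      using c j by (auto simp: consecutive_zeros_def M_star_def)
    ultimately have "j \<in> zero_rows (M_star G vs) j" using k \<open>\<not> i < j\<close> by auto
    then show False using zr[of j j] j by (auto simp: non_nbhd_def)
  qed
  have NA: "w \<notin> A" if vw: "v \<in> A" "w \<in> set vs" "w \<in> ?N v" for v w
  proof
    assume "w \<in> A"
    obtain j where j: "j \<in> C1 G vs" "v = vs ! j" using vw(1) by (auto simp: A_def)
    obtain i where i: "i \<in> C1 G vs" "w = vs ! i" using \<open>w \<in> A\<close> by (auto simp: A_def)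
    have "j < i" using below[OF j(1), of i] i j vw by (auto simp: C1_def)
    moreover have "i < j" using below[OF i(1), of j] i j vw Nsym[of w v] by (auto simp: C1_def)
    ultimately show False by simp
  qed
  have NB: "w \<in> A" if vw: "v \<in> set vs" "v \<notin> A" "w \<in> set vs" "w \<in> ?N v" for v w
  proof (rule ccontr)
    assume "w \<notin> A"
    obtain j where j: "j < length vs" "v = vs ! j" using vw(1) unfolding in_set_conv_nth by blast
    obtain i where i: "i < length vs" "w = vs ! i" using vw(3) unfolding in_set_conv_nth by blast
    have "i < j" using above[of j i] i j vw A_nth[of j] by blast
    moreover have "j < i" using above[of i j] i j vw A_nth[of i] \<open>w \<notin> A\<close> Nsym[of w v] by blast
    ultimately show False by simp
  qed
  let ?fA = "filter (\<lambda>x. x \<in> A)" and ?fB = "filter (\<lambda>x. x \<notin> A)"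
  define ws where "ws = ?fA vs @ ?fB vs"
  define r where "r = length (?fA vs)"
  have dw: "distinct ws" and sw: "set ws = set vs" using d by (auto simp: ws_def)
  have "\<exists>xs ys zs. ws = xs @ ys @ zs \<and> set xs \<inter> ?N v = {} \<and> set ys \<subseteq> ?N v \<and> set zs \<inter> ?N v = {}"
    if v: "v \<in> set vs" for v
  proof -
    obtain xs ys zs where s: "vs = xs @ ys @ zs" "set xs \<inter> ?N v = {}"
      "set ys \<subseteq> ?N v" "set zs \<inter> ?N v = {}"
      using c v unfolding consecutive_zeros_M_star[OF d] by blast
    show ?thesis
    proof (cases "v \<in> A")
      case True
      have out: "x \<notin> A" if "x \<in> set vs" "x \<in> ?N v" for x
        using NA[OF True] that by blast
      have ysv: "set ys \<subseteq> set vs" using s(1) by auto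
      have "?fA ys = []" unfolding filter_empty_conv using out s(3) ysv by blast
      moreover have "?fB ys = ys" using out s(3) ysv by (intro filter_True) blast
      ultimately have "?fB vs = ?fB xs @ ys @ ?fB zs" unfolding s(1) by simp
      then have "ws = (?fA vs @ ?fB xs) @ ys @ (?fB zs)" unfolding ws_def by simp
      moreover have "set (?fA vs) \<inter> ?N v = {}" using out by auto
      then have "set (?fA vs @ ?fB xs) \<inter> ?N v = {}" "set (?fB zs) \<inter> ?N v = {}"
        using s(2,4) by auto
      ultimately show ?thesis using s(3) by blast
    next
      case False
      have out: "x \<in> A" if "x \<in> set vs" "x \<in> ?N v" for x
        using NB[OF v False] that by blast
      have ysv: "set ys \<subseteq> set vs" using s(1) by auto
      have "?fB ys = []" unfolding filter_empty_conv using out s(3) ysv by blast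
      moreover have "?fA ys = ys" using out s(3) ysv by (intro filter_True) blast
      ultimately have "?fA vs = ?fA xs @ ys @ ?fA zs" unfolding s(1) by simp
      then have "ws = (?fA xs) @ ys @ (?fA zs @ ?fB vs)" unfolding ws_def by simp
      moreover have "set (?fB vs) \<inter> ?N v = {}" using out by auto
      then have "set (?fA xs) \<inter> ?N v = {}" "set (?fA zs @ ?fB vs) \<inter> ?N v = {}"
        using s(2,4) by auto
      ultimately show ?thesis using s(3) by blast
    qed
  qed
  then have cw: "consecutive_zeros (M_star G ws)"
    unfolding consecutive_zeros_M_star[OF dw] sw by blast
  have rl: "r \<le> length ws" by (simp add: r_def ws_def)
  have wsA: "ws ! i \<in> A \<longleftrightarrow> i < r" if "i < length ws" for i
  proof (cases "i < r")
    case True then show ?thesis using nth_mem[of i "?fA vs"] by (auto simp: ws_def r_def nth_append)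
  next
    case False
    then have "ws ! i = ?fB vs ! (i - r)" "i - r < length (?fB vs)"
      using that by (auto simp: ws_def r_def nth_append)
    then show ?thesis using False nth_mem[of "i - r" "?fB vs"] by auto
  qed
  have zw: "i \<in> zero_rows (M_star G ws) j \<longleftrightarrow> i < length ws \<and> ws ! i \<in> ?N (ws ! j)"
    if "j < length ws" for i j
    using that dw by (auto simp: zero_rows_M_star)
  have zA: "r \<le> i" if "j < r" "i \<in> zero_rows (M_star G ws) j" for i j
  proof -
    have j: "j < length ws" using that rl by simp
    have i: "i < length ws" "ws ! i \<in> ?N (ws ! j)" using zw[OF j] that by auto
    then have "ws ! i \<notin> A" using NA[of "ws ! j" "ws ! i"] wsA[OF j] that sw nth_mem[OF i(1)] by auto
    then show ?thesis using wsA[OF i(1)] by auto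
  qed
  have zB: "i < r" if "r \<le> j" "j < length ws" "i \<in> zero_rows (M_star G ws) j" for i j
  proof -
    have i: "i < length ws" "ws ! i \<in> ?N (ws ! j)" using zw[OF that(2)] that by auto
    then have "ws ! i \<in> A"
      using NB[of "ws ! j" "ws ! i"] wsA[OF that(2)] that sw nth_mem[OF i(1)] nth_mem[OF that(2)] by auto
    then show ?thesis using wsA[OF i(1)] by auto
  qed
  have ne: "\<exists>i. i \<in> zero_rows (M_star G ws) j" if "j < length ws" for j
  proof -
    have "ws ! j \<in> set vs" using sw nth_mem[OF that] by simp
    from Nne[OF this] obtain w where "w \<in> set ws" "w \<in> ?N (ws ! j)" unfolding sw by blast
    then show ?thesis using zw[OF that] unfolding in_set_conv_nth by blast
  qed
  have "C1 G ws = {..<r}"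
  proof (intro equalityI subsetI)
    fix j assume j: "j \<in> C1 G ws"
    then have jl: "j < length ws" by (auto simp: C1_def)
    obtain i where i: "i \<in> zero_rows (M_star G ws) j" using ne[OF jl] by blast
    then have "j < i" using j by (auto simp: C1_def)
    then show "j \<in> {..<r}" using zB[OF _ jl i] by (cases "r \<le> j") auto
  next
    fix j assume "j \<in> {..<r}"
    then show "j \<in> C1 G ws" using zA rl by (fastforce simp: C1_def)
  qed
  moreover have "C2 G ws = {r..<length ws}"
  proof (intro equalityI subsetI)
    fix j assume j: "j \<in> C2 G ws"
    then have jl: "j < length ws" by (auto simp: C2_def)
    obtain i where i: "i \<in> zero_rows (M_star G ws) j" using ne[OF jl] by blast
    then have "i < j" using j by (auto simp: C2_def)
    then show "j \<in> {r..<length ws}" using zA[OF _ i] jl by (cases "r \<le> j") auto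
  next
    fix j assume "j \<in> {r..<length ws}"
    then show "j \<in> C2 G ws" using zB by (fastforce simp: C2_def)
  qed
  ultimately show ?thesis
    using dw sw sv cw rl by (auto simp: clique_ordering_def vertex_enum_def)
qed

text \<open>Hence a quantification over the admissible orderings of \<open>G - U\<close> is never vacuous.\<close>
lemma ex_clique_ordering_non_universal:
  assumes "graph G" "co_biconvex G"
  shows "\<exists>vs. clique_ordering (G \<restriction> (verts G - universal_vertices G)) vs"
proof (rule ex_clique_ordering)
  interpret graph G by fact
  show "symmetric (G \<restriction> (verts G - universal_vertices G))"
  proof -
    have "v \<rightarrow>\<^bsub>G\<^esub> u" if "u \<rightarrow>\<^bsub>G\<^esub> v" for u v
      using sym_arcs that by (auto simp: symmetric_def dest: symD)
    then have "v \<rightarrow>\<^bsub>G \<restriction> S\<^esub> u" if "u \<rightarrow>\<^bsub>G \<restriction> S\<^esub> v" for u v S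
      using that dominates_induce_iff[of u S v G] dominates_induce_iff[of v S u G]
      by (auto simp: arcs_ends_conv)
    then show ?thesis by (auto simp: symmetric_def intro: symI)
  qed
qed (use assms co_biconvex_induce universal_vertices_induce in auto)

end

(* A k-tuple dominating set with only k elements lies in every closed neighbourhood, so it consists
   of universal vertices; this gives the lower bounds 2 and 3. The vertices outside U are covered by
   the two cliques C1 and C2, so two vertices of one clique serve that clique twice, and one vertex of
   the other clique serves it once more. Two vertices of C1 whose zero intervals are disjoint have no
   common non-neighbour in C2 and hence dominate C2 as well. If instead the intervals of C1 meet
   pairwise, they have a common point (Helly), that is, some vertex of C2 has its whole closed
   neighbourhood inside C2; if both families do so, each clique must contain two vertices of the
   dominating set. Connectedness guarantees that both cliques then have two vertices. *)

theory Submission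
  imports Defs
begin

section \<open>Adjacency in symmetric graphs\<close>

lemma two_le_card:
  assumes "finite A" "x \<in> A" "y \<in> A" "x \<noteq> y"
  shows "2 \<le> card A"
  using card_mono[of A "{x, y}"] assms by simp

lemma graph_adj_commute:
  assumes "graph G"
  shows "u \<rightarrow>\<^bsub>G\<^esub> v \<longleftrightarrow> v \<rightarrow>\<^bsub>G\<^esub> u"
proof -
  interpret graph G by fact
  show ?thesis using sym_arcs by (auto simp: symmetric_def dest: symD)
qed

lemma graph_adj_in_verts:
  assumes "graph G" "u \<rightarrow>\<^bsub>G\<^esub> v"
  shows "u \<in> verts G" "v \<in> verts G"
proof -
  interpret graph G by fact
  show "u \<in> verts G" "v \<in> verts G" using assms(2) by (auto dest: adj_in_verts)
qed

text \<open>In a connected symmetric digraph a path leads from \<open>u\<close> to any other vertex;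
  its first arc does not return to \<open>u\<close>, as there are no loops.\<close>

lemma connected_ex_neighbour:
  assumes "graph G" "Digraph_Component.connected G" "2 \<le> card (verts G)" "u \<in> verts G"
  shows "\<exists>v. v \<noteq> u \<and> u \<rightarrow>\<^bsub>G\<^esub> v"
proof -
  interpret graph G by fact
  have "\<not> verts G \<subseteq> {u}" using card_mono[of "{u}" "verts G"] assms(3) by auto
  then obtain w where w: "w \<in> verts G" "w \<noteq> u" by blast
  have "u \<rightarrow>\<^sup>*\<^bsub>G\<^esub> w"
    using symmetric_connected_imp_strongly_connected[OF sym_arcs assms(2)] assms(4) w(1)
    by (auto simp: strongly_connected_def)
  then obtain v where "u \<rightarrow>\<^bsub>G\<^esub> v" by (cases rule: converse_reachable_cases) (use w(2) in auto)
  moreover have "\<not> u \<rightarrow>\<^bsub>G\<^esub> u" using no_loops by (auto simp: arcs_ends_conv)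
  ultimately show ?thesis by metis
qed

subsection \<open>Tuple domination\<close>

text \<open>All dominating sets are subsets of the finite set \<open>verts G\<close>, so
  \<open>Min\<close> ranges over a finite set and an attained lower bound is its value.\<close>

lemma tuple_domination_number_eqI:
  assumes "finite (verts G)" "tuple_dominating k G D" "card D = m"
    and "\<And>E. tuple_dominating k G E \<Longrightarrow> m \<le> card E"
  shows "tuple_domination_number k G = m"
  unfolding tuple_domination_number_def
proof (rule Min_eqI)
  have "{D. tuple_dominating k G D} \<subseteq> Pow (verts G)" by (auto simp: tuple_dominating_def)
  then show "finite (card ` {D. tuple_dominating k G D})"
    using assms(1) finite_subset by blast
qed (use assms in auto)

lemma tuple_dominating_card_ge:
  assumes "finite (verts G)" "verts G \<noteq> {}" "tuple_dominating k G D"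
  shows "k \<le> card D"
proof -
  obtain v where "v \<in> verts G" using assms(2) by blast
  then have "k \<le> card (closed_nbhd G v \<inter> D)" using assms(3) by (simp add: tuple_dominating_def)
  also have "\<dots> \<le> card D"
    using assms(1,3) by (intro card_mono) (auto simp: tuple_dominating_def intro: finite_subset)
  finally show ?thesis .
qed

text \<open>Each closed neighbourhood contains at least \<open>k\<close> of the at most
  \<open>k\<close> elements of \<open>D\<close>, hence all of them. With \<open>k = 2\<close> this
  yields the lower bound 3 when fewer than two vertices are universal.\<close>

lemma tuple_dominating_tight_subset_universal:
  assumes "graph G" "tuple_dominating k G D" "card D \<le> k"
  shows "D \<subseteq> universal_vertices G"
proof
  interpret graph G by fact
  fix d assume d: "d \<in> D"
  have D: "D \<subseteq> verts G" "finite D"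
    using assms(2) by (auto simp: tuple_dominating_def intro: finite_subset)
  have "D \<subseteq> closed_nbhd G v" if v: "v \<in> verts G" for v
  proof -
    have "k \<le> card (closed_nbhd G v \<inter> D)" using v assms(2) by (simp add: tuple_dominating_def)
    then have "closed_nbhd G v \<inter> D = D"
      using D(2) assms(3) by (intro card_seteq) auto
    then show ?thesis by blast
  qed
  then have "d \<rightarrow>\<^bsub>G\<^esub> w" if "w \<in> verts G" "w \<noteq> d" for w
    using that d graph_adj_commute[OF assms(1)] by (fastforce simp: closed_nbhd_def)
  then show "d \<in> universal_vertices G" using d D by (auto simp: universal_vertices_def)
qed

text \<open>Two explicit witnesses replace the cardinality bound; adjacency is directed from the
  witness to \<open>v\<close>, the form in which the clique lemmas below supply it.\<close>

lemma tuple_dominating_twoI: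
  assumes "graph G" "D \<subseteq> verts G"
    and "\<And>v. v \<in> verts G \<Longrightarrow>
      \<exists>x \<in> D. \<exists>y \<in> D. x \<noteq> y \<and> (x = v \<or> x \<rightarrow>\<^bsub>G\<^esub> v) \<and> (y = v \<or> y \<rightarrow>\<^bsub>G\<^esub> v)"
  shows "tuple_dominating 2 G D"
  unfolding tuple_dominating_def
proof (intro conjI ballI)
  interpret graph G by fact
  show "D \<subseteq> verts G" by fact
  fix v assume "v \<in> verts G"
  then obtain x y where xy: "x \<in> D" "y \<in> D" "x \<noteq> y" "x = v \<or> x \<rightarrow>\<^bsub>G\<^esub> v" "y = v \<or> y \<rightarrow>\<^bsub>G\<^esub> v"
    using assms(3) by blast
  have "w \<in> closed_nbhd G v" if "w \<in> D" "w = v \<or> w \<rightarrow>\<^bsub>G\<^esub> v" for w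
    using that assms(2) graph_adj_commute[OF assms(1)] by (auto simp: closed_nbhd_def)
  then show "2 \<le> card (closed_nbhd G v \<inter> D)"
    using xy finite_subset[OF assms(2)] by (intro two_le_card[of _ x y]) auto
qed

text \<open>This serves the lower bound 4, with \<open>A\<close> the vertex set of one
  clique.\<close>

lemma tuple_dominating_two_meets_twice:
  assumes "finite D" "tuple_dominating 2 G D" "v \<in> verts G" "closed_nbhd G v \<subseteq> A"
  shows "2 \<le> card (D \<inter> A)"
proof -
  have "2 \<le> card (closed_nbhd G v \<inter> D)" using assms by (simp add: tuple_dominating_def)
  also have "\<dots> \<le> card (D \<inter> A)" using assms by (intro card_mono) auto
  finally show ?thesis .
qed

subsection \<open>Intersection graphs\<close>

lemma intersection_graph_adj:
  "i \<rightarrow>\<^bsub>with_proj (intersection_graph J I)\<^esub> j \<longleftrightarrow> i \<in> J \<and> j \<in> J \<and> i \<noteq> j \<and> I i \<inter> I j \<noteq> {}"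
  by (simp add: intersection_graph_def)

lemma independent_in_intersection_graph:
  "independent_in (with_proj (intersection_graph J I)) T \<longleftrightarrow>
     T \<subseteq> J \<and> (\<forall>i \<in> T. \<forall>j \<in> T. i \<noteq> j \<longrightarrow> I i \<inter> I j = {})"
  unfolding independent_in_def intersection_graph_adj
  by (auto simp: intersection_graph_def)

lemma finite_independent_cards:
  assumes "finite J"
  shows "finite (card ` {T. independent_in (with_proj (intersection_graph J I)) T})"
proof -
  have "{T. independent_in (with_proj (intersection_graph J I)) T} \<subseteq> Pow J"
    by (auto simp: independent_in_intersection_graph)
  then show ?thesis using assms finite_subset by blast
qed

text \<open>Subsets of independent sets are independent, so a set of size at least 2 can be cut down
  to a pair. The conditions on \<open>\<alpha>\<^sub>1\<close> and \<open>\<alpha>\<^sub>2\<close>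
  thus become statements about two disjoint intervals.\<close>

lemma two_le_independence_number_intersection_graph:
  assumes "finite J"
  shows "2 \<le> independence_number (with_proj (intersection_graph J I)) \<longleftrightarrow>
    (\<exists>i \<in> J. \<exists>j \<in> J. i \<noteq> j \<and> I i \<inter> I j = {})" (is "2 \<le> ?\<alpha> \<longleftrightarrow> ?R")
proof
  let ?C = "card ` {T. independent_in (with_proj (intersection_graph J I)) T}"
  have fin: "finite ?C" using assms by (rule finite_independent_cards)
  \<comment> \<open>The empty set is independent, so the maximum is taken over a nonempty set and is
    attained.\<close>
  have "independent_in (with_proj (intersection_graph J I)) {}"
    by (simp add: independent_in_intersection_graph)
  then have "?C \<noteq> {}" by blast
  then have in_C: "?\<alpha> \<in> ?C" unfolding independence_number_def using fin by (rule Max_in[rotated])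
  show ?R if "2 \<le> ?\<alpha>"
  proof -
    obtain T where T: "?\<alpha> = card T" "independent_in (with_proj (intersection_graph J I)) T"
      using in_C by (elim imageE CollectE)
    then have "2 \<le> card T" using that by metis
    then obtain P where P: "P \<subseteq> T" "card P = 2" by (rule obtain_subset_with_card_n)
    then obtain i j where "P = {i, j}" "i \<noteq> j" unfolding card_2_iff by blast
    then have "i \<in> T" "j \<in> T" "i \<noteq> j" using P(1) by auto
    moreover have "T \<subseteq> J" "\<forall>i \<in> T. \<forall>j \<in> T. i \<noteq> j \<longrightarrow> I i \<inter> I j = {}"
      using T(2) unfolding independent_in_intersection_graph by simp_all
    ultimately show ?R by (meson subsetD)
  qed
  show "2 \<le> ?\<alpha>" if ?R
  proof -
    obtain i j where ij: "i \<in> J" "j \<in> J" "i \<noteq> j" "I i \<inter> I j = {}" using \<open>?R\<close> by blast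
    then have "independent_in (with_proj (intersection_graph J I)) {i, j}"
      by (auto simp: independent_in_intersection_graph)
    then have "card {i, j} \<in> ?C" by blast
    then have "card {i, j} \<le> ?\<alpha>" unfolding independence_number_def by (rule Max_ge[OF fin])
    then show ?thesis using ij(3) by simp
  qed
qed

subsection \<open>Clique orderings of an induced subgraph\<close>

text \<open>One setting covers two cases: \<open>S\<close> is \<open>verts G\<close> if there are no
  universal vertices, and \<open>verts G\<close> without \<open>u\<close> if \<open>u\<close> is the
  only one.\<close>

locale clique_ordered = graph G for G :: "('a, 'b) pre_digraph" (structure) +
  fixes S :: "'a set" and vs :: "'a list"
  assumes S_verts: "S \<subseteq> verts G"
    and ordering: "clique_ordering (G \<restriction> S) vs"
begin

abbreviation zeros :: "nat \<Rightarrow> nat set" where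
  "zeros \<equiv> zero_rows (M_star (G \<restriction> S) vs)"

abbreviation part1 :: "nat set" where "part1 \<equiv> C1 (G \<restriction> S) vs"
abbreviation part2 :: "nat set" where "part2 \<equiv> C2 (G \<restriction> S) vs"

text \<open>Symmetric in the two cliques, so that each fact about one of them is proved once and
  used for both.\<close>

definition parts :: "nat set \<Rightarrow> nat set \<Rightarrow> bool" where
  "parts J K \<longleftrightarrow> J = part1 \<and> K = part2 \<or> J = part2 \<and> K = part1"

lemma parts12: "parts part1 part2" and parts21: "parts part2 part1"
  by (auto simp: parts_def)

lemma distinct_vs: "distinct vs" and set_vs: "set vs = S"
  using ordering by (auto simp: clique_ordering_def vertex_enum_def)

lemma parts_Un: "parts J K \<Longrightarrow> J \<union> K = {..<length vs}"
  and parts_disjoint: "parts J K \<Longrightarrow> J \<inter> K = {}"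
  using ordering by (auto simp: parts_def clique_ordering_def)

lemma parts_nth_in: "parts J K \<Longrightarrow> j \<in> J \<Longrightarrow> vs ! j \<in> S"
  using parts_Un set_vs nth_mem by blast

text \<open>Both vertices lie in \<open>S\<close>, where adjacency in the induced subgraph agrees
  with adjacency in \<open>G\<close>; later arguments can therefore speak of \<open>G\<close>
  itself.\<close>

lemma mem_zeros:
  assumes "i < length vs" "j < length vs"
  shows "i \<in> zeros j \<longleftrightarrow> i \<noteq> j \<and> \<not> vs ! i \<rightarrow>\<^bsub>G\<^esub> vs ! j"
proof -
  have "vs ! i \<in> S" "vs ! j \<in> S" using assms set_vs nth_mem by blast+
  then show ?thesis
    using assms distinct_vs
    by (auto simp: zero_rows_M_star non_nbhd_def dominates_induce_iff nth_eq_iff_index_eq)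
qed

lemma zeros_sym: "i \<in> zeros j \<longleftrightarrow> j \<in> zeros i" if "i < length vs" "j < length vs"
  using mem_zeros that graph_adj_commute[OF graph_axioms] by blast

lemma zeros_less: "i \<in> zeros j \<Longrightarrow> i < length vs"
  by (simp add: zero_rows_def M_star_def)

text \<open>A column without zeros would satisfy the conditions for both \<open>C1\<close> and
  \<open>C2\<close> vacuously, but the ordering makes these sets disjoint.\<close>

lemma zeros_nonempty:
  assumes "j < length vs"
  shows "zeros j \<noteq> {}"
proof
  assume "zeros j = {}"
  then have "j \<in> part1" "j \<in> part2" using assms by (auto simp: C1_def C2_def)
  then show False using parts_disjoint[OF parts12] by blast
qed

text \<open>Being a zero is a symmetric relation, so two related indices of the same part would each
  have to lie on the same side of the other.\<close>

lemma zeros_subset: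
  assumes "parts J K" "j \<in> J"
  shows "zeros j \<subseteq> K"
proof
  fix i assume i: "i \<in> zeros j"
  have lt: "i < length vs" "j < length vs" using zeros_less[OF i] parts_Un[OF assms(1)] assms(2) by auto
  then have j: "j \<in> zeros i" using zeros_sym i by blast
  have "i \<notin> J"
    using assms i j unfolding parts_def C1_def C2_def by fastforce
  then show "i \<in> K" using lt parts_Un[OF assms(1)] by auto
qed

lemma parts_clique:
  assumes "parts J K" "i \<in> J" "j \<in> J" "i \<noteq> j"
  shows "vs ! i \<rightarrow>\<^bsub>G\<^esub> vs ! j"
proof -
  have "i < length vs" "j < length vs" using parts_Un[OF assms(1)] assms(2,3) by auto
  moreover have "i \<notin> zeros j"
    using zeros_subset[OF assms(1,3)] parts_disjoint[OF assms(1)] assms(2) by blast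
  ultimately show ?thesis using assms(4) mem_zeros by blast
qed

lemma parts_clique_refl:
  assumes "parts J K" "i \<in> J" "j \<in> J" "v = vs ! j"
  shows "vs ! i = v \<or> vs ! i \<rightarrow>\<^bsub>G\<^esub> v"
  using parts_clique[OF assms(1-3)] assms(4) by auto

text \<open>If one part were empty, position 0 would lie in the other, and its nonempty set of zeros
  would have to lie in the empty part.\<close>

lemma parts_nonempty:
  assumes "parts J K" "S \<noteq> {}"
  shows "J \<noteq> {}"
proof
  assume J: "J = {}"
  have "0 < length vs" using assms(2) set_vs by auto
  then have "0 \<in> K" and z: "zeros 0 \<noteq> {}" using parts_Un[OF assms(1)] J zeros_nonempty by auto
  then show False
    using zeros_subset[of K J 0] assms(1) J by (auto simp: parts_def)
qed

section \<open>Disjoint and pairwise intersecting zero intervals\<close>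

lemma zeros_consecutive: "j < length vs \<Longrightarrow> \<exists>p q. zeros j = {p..<q}"
  using ordering by (simp add: clique_ordering_def consecutive_zeros_def dim_col_M_star)

lemma mem_zeros_iff_between:
  assumes "j < length vs"
  shows "m \<in> zeros j \<longleftrightarrow> Min (zeros j) \<le> m \<and> m \<le> Max (zeros j)"
proof -
  obtain p q where pq: "zeros j = {p..<q}" using zeros_consecutive assms by blast
  then have "p < q" using zeros_nonempty[OF assms] by auto
  \<comment> \<open>The bound \<open>q\<close> is exclusive, so the last zero is
    \<open>q - 1\<close>; since \<open>p < q\<close>, the subtraction is not truncated.\<close>
  define r where "r = q - 1"
  have zj: "zeros j = {p..r}" "p \<le> r" using \<open>p < q\<close> unfolding pq r_def by auto
  have "Min {p..r} = p" "Max {p..r} = r" using zj(2) by (auto intro: Min_eqI Max_eqI)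
  then show ?thesis unfolding zj(1) by simp
qed

text \<open>Every zero is an integer point of the interval of its column.\<close>

lemma zero_interval_disjoint:
  assumes "i < length vs" "j < length vs"
    and "zero_interval (G \<restriction> S) vs i \<inter> zero_interval (G \<restriction> S) vs j = {}"
  shows "zeros i \<inter> zeros j = {}"
proof -
  have "real m \<in> zero_interval (G \<restriction> S) vs k" if "m \<in> zeros k" "k < length vs" for m k
    using that mem_zeros_iff_between[OF that(2), of m] by (simp add: zero_interval_def)
  then show ?thesis using assms by blast
qed

text \<open>A vertex of \<open>K\<close> adjacent to neither \<open>i\<close> nor \<open>j\<close>
  would be a zero of both columns, hence a point of both intervals.\<close>

lemma disjoint_intervals_dominate:
  assumes "parts J K" and "2 \<le> independence_number
      (with_proj (intersection_graph J (zero_interval (G \<restriction> S) vs)))"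
  shows "\<exists>i \<in> J. \<exists>j \<in> J. i \<noteq> j \<and> (\<forall>k \<in> K. vs ! i \<rightarrow>\<^bsub>G\<^esub> vs ! k \<or> vs ! j \<rightarrow>\<^bsub>G\<^esub> vs ! k)"
proof -
  have lt: "k < length vs" if "k \<in> J \<union> K" for k using that parts_Un[OF assms(1)] by auto
  then have "finite J" using finite_subset[of J "{..<length vs}"] by blast
  then obtain i j where ij: "i \<in> J" "j \<in> J" "i \<noteq> j"
    "zero_interval (G \<restriction> S) vs i \<inter> zero_interval (G \<restriction> S) vs j = {}"
    using iffD1[OF two_le_independence_number_intersection_graph assms(2)] by blast
  have "zeros i \<inter> zeros j = {}" using zero_interval_disjoint ij lt by blast
  moreover have "k \<in> zeros i" if "k \<in> K" "\<not> vs ! i \<rightarrow>\<^bsub>G\<^esub> vs ! k" "i \<in> J" for i k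
    using that lt mem_zeros[of i k] zeros_sym[of i k] parts_disjoint[OF assms(1)] by blast
  ultimately show ?thesis using ij by blast
qed

text \<open>Helly's theorem on the line: the largest left endpoint lies in every interval. Being the
  first zero of some column, it is a position in \<open>K\<close> and not merely a real
  number.\<close>

lemma pairwise_intersecting_common_zero:
  assumes "parts J K" "J \<noteq> {}" and "independence_number
      (with_proj (intersection_graph J (zero_interval (G \<restriction> S) vs))) < 2"
  shows "\<exists>k \<in> K. \<forall>j \<in> J. \<not> vs ! k \<rightarrow>\<^bsub>G\<^esub> vs ! j"
proof -
  let ?min = "\<lambda>j. Min (zeros j)" and ?max = "\<lambda>j. Max (zeros j)"
  have lt: "k < length vs" if "k \<in> J \<union> K" for k using that parts_Un[OF assms(1)] by auto
  then have fin: "finite J" using finite_subset[of J "{..<length vs}"] by blast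
  have "finite (?min ` J)" "?min ` J \<noteq> {}" using fin assms(2) by auto
  then have "Max (?min ` J) \<in> ?min ` J" by (rule Max_in)
  \<comment> \<open>The interval of \<open>m\<close> starts last; its left endpoint is the candidate
    for the common point.\<close>
  then obtain m where m: "m \<in> J" "Max (?min ` J) = ?min m" by auto
  then have le: "?min j \<le> ?min m" if "j \<in> J" for j
    using that Max_ge[OF \<open>finite (?min ` J)\<close>] by (metis imageI)
  have fz: "finite (zeros j)" for j
    by (rule finite_subset[of _ "{..<length vs}"]) (auto dest: zeros_less)
  have common: "?min m \<in> zeros j" if j: "j \<in> J" for j
  proof (cases "j = m")
    case True then show ?thesis using Min_in[OF fz] zeros_nonempty lt j by blast
  next
    case False
    then have "zero_interval (G \<restriction> S) vs j \<inter> zero_interval (G \<restriction> S) vs m \<noteq> {}"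
      using assms(3) two_le_independence_number_intersection_graph[OF fin] j m(1)
      by (meson not_le)
    \<comment> \<open>The intervals of \<open>j\<close> and \<open>m\<close> meet, so the latter
      cannot start after the former ends.\<close>
    then have "?min m \<le> ?max j" by (auto simp: zero_interval_def)
    then show ?thesis using le[OF j] mem_zeros_iff_between[of j "?min m"] lt j by blast
  qed
  have K: "?min m \<in> K" using common[OF m(1)] zeros_subset[OF assms(1) m(1)] by blast
  moreover have "\<not> vs ! ?min m \<rightarrow>\<^bsub>G\<^esub> vs ! j" if "j \<in> J" for j
    using common[OF that] mem_zeros[of "?min m" j] lt K that by simp
  ultimately show ?thesis by blast
qed

section \<open>The two cliques as sets of vertices\<close>

lemma S_eq_parts:
  assumes "parts J K"
  shows "S = (!) vs ` J \<union> (!) vs ` K"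
proof -
  have "S = (!) vs ` {..<length vs}" unfolding set_vs[symmetric] set_conv_nth by blast
  then show ?thesis unfolding parts_Un[OF assms, symmetric] image_Un .
qed

lemma parts_nth_disjoint:
  assumes "parts J K"
  shows "(!) vs ` J \<inter> (!) vs ` K = {}"
proof -
  have "vs ! j \<noteq> vs ! k" if "j \<in> J" "k \<in> K" for j k
  proof -
    have "j < length vs" "k < length vs" using that parts_Un[OF assms] by auto
    moreover have "j \<noteq> k" using that parts_disjoint[OF assms] by blast
    ultimately show ?thesis using distinct_vs by (simp add: nth_eq_iff_index_eq)
  qed
  then show ?thesis by blast
qed

lemma parts_nth_inj:
  assumes "parts J K" "i \<in> J" "j \<in> J" "i \<noteq> j"
  shows "vs ! i \<noteq> vs ! j"
proof -
  have "i < length vs" "j < length vs" using assms parts_Un[OF assms(1)] by auto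
  then show ?thesis using assms(4) distinct_vs by (simp add: nth_eq_iff_index_eq)
qed

section \<open>Dominating sets of size three\<close>

text \<open>Take \<open>u\<close> and one vertex of each clique: \<open>u\<close> serves every
  vertex once, and each clique is served again by its representative.\<close>

lemma dominating_universal:
  assumes "u \<in> universal_vertices G" "u \<notin> S" "verts G = insert u S" "S \<noteq> {}"
  shows "\<exists>D. tuple_dominating 2 G D \<and> card D = 3"
proof -
  obtain i k where ik: "i \<in> part1" "k \<in> part2"
    using parts_nonempty[OF parts12] parts_nonempty[OF parts21] assms(4) by blast
  let ?x = "vs ! i" and ?y = "vs ! k"
  have xy: "?x \<in> S" "?y \<in> S" "?x \<noteq> ?y"
    using ik parts_nth_in[OF parts12] parts_nth_in[OF parts21] parts_nth_disjoint[OF parts12] by auto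
  have "tuple_dominating 2 G {u, ?x, ?y}"
  proof (rule tuple_dominating_twoI[OF graph_axioms])
    show "{u, ?x, ?y} \<subseteq> verts G" using xy assms(3) by auto
    fix v assume v: "v \<in> verts G"
    have u: "u = v \<or> u \<rightarrow>\<^bsub>G\<^esub> v" using assms(1) v by (auto simp: universal_vertices_def)
    consider "v = u" | j where "j \<in> part1" "v = vs ! j" | j where "j \<in> part2" "v = vs ! j"
      using v assms(3) S_eq_parts[OF parts12] by blast
    then have "(?x = v \<or> ?x \<rightarrow>\<^bsub>G\<^esub> v) \<or> (?y = v \<or> ?y \<rightarrow>\<^bsub>G\<^esub> v)"
    proof cases
      case 1
      \<comment> \<open>The vertex \<open>u\<close> counts itself once, so it needs one further
        neighbour in the set.\<close>
      then have "u \<rightarrow>\<^bsub>G\<^esub> ?x" using assms(1,2,3) xy by (auto simp: universal_vertices_def)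
      then show ?thesis using 1 graph_adj_commute[OF graph_axioms] by blast
    next
      case (2 j) then show ?thesis using parts_clique_refl[OF parts12 ik(1)] by blast
    next
      case (3 j) then show ?thesis using parts_clique_refl[OF parts21 ik(2)] by blast
    qed
    moreover have "u \<noteq> ?x" "u \<noteq> ?y" using xy assms(2) by auto
    ultimately show "\<exists>x \<in> {u, ?x, ?y}. \<exists>y \<in> {u, ?x, ?y}. x \<noteq> y \<and> (x = v \<or> x \<rightarrow>\<^bsub>G\<^esub> v) \<and> (y = v \<or> y \<rightarrow>\<^bsub>G\<^esub> v)"
      using u by blast
  qed
  moreover have "card {u, ?x, ?y} = 3" using xy assms(2) by (auto simp: card_insert_if)
  ultimately show ?thesis by blast
qed

text \<open>Take two vertices of \<open>J\<close> with disjoint intervals and any vertex of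
  \<open>K\<close>. The pair serves \<open>J\<close> twice; a vertex of \<open>K\<close> is served
  by the third vertex and by at least one of the pair.\<close>

lemma dominating_disjoint_intervals:
  assumes "parts J K" "S = verts G" "S \<noteq> {}" and "2 \<le> independence_number
      (with_proj (intersection_graph J (zero_interval (G \<restriction> S) vs)))"
  shows "\<exists>D. tuple_dominating 2 G D \<and> card D = 3"
proof -
  have KJ: "parts K J" using assms(1) by (auto simp: parts_def)
  obtain i j where ij: "i \<in> J" "j \<in> J" "i \<noteq> j"
    and dom: "\<And>k. k \<in> K \<Longrightarrow> vs ! i \<rightarrow>\<^bsub>G\<^esub> vs ! k \<or> vs ! j \<rightarrow>\<^bsub>G\<^esub> vs ! k"
    using disjoint_intervals_dominate[OF assms(1,4)] by blast
  obtain k where k: "k \<in> K" using parts_nonempty[OF KJ assms(3)] by blast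
  let ?x = "vs ! i" and ?y = "vs ! j" and ?z = "vs ! k"
  have ne: "?x \<noteq> ?y" "?x \<noteq> ?z" "?y \<noteq> ?z"
    using ij k parts_nth_inj[OF assms(1)] parts_nth_disjoint[OF assms(1)] by auto
  have "tuple_dominating 2 G {?x, ?y, ?z}"
  proof (rule tuple_dominating_twoI[OF graph_axioms])
    show "{?x, ?y, ?z} \<subseteq> verts G"
      using ij k parts_nth_in[OF assms(1)] parts_nth_in[OF KJ] assms(2) by auto
    fix v assume "v \<in> verts G"
    then consider l where "l \<in> J" "v = vs ! l" | l where "l \<in> K" "v = vs ! l"
      using S_eq_parts[OF assms(1)] assms(2) by blast
    then show "\<exists>x \<in> {?x, ?y, ?z}. \<exists>y \<in> {?x, ?y, ?z}. x \<noteq> y \<and> (x = v \<or> x \<rightarrow>\<^bsub>G\<^esub> v) \<and> (y = v \<or> y \<rightarrow>\<^bsub>G\<^esub> v)"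
    proof cases
      case (1 l)
      then have "?x = v \<or> ?x \<rightarrow>\<^bsub>G\<^esub> v" "?y = v \<or> ?y \<rightarrow>\<^bsub>G\<^esub> v"
        using parts_clique_refl[OF assms(1)] ij(1,2) by blast+
      then show ?thesis using ne by blast
    next
      case (2 l)
      then have z: "?z = v \<or> ?z \<rightarrow>\<^bsub>G\<^esub> v" using parts_clique_refl[OF KJ k] by blast
      have "?x \<rightarrow>\<^bsub>G\<^esub> v \<or> ?y \<rightarrow>\<^bsub>G\<^esub> v" using dom 2 by simp
      then show ?thesis
      proof
        assume "?x \<rightarrow>\<^bsub>G\<^esub> v"
        then show ?thesis using z ne(2) by (intro bexI[of _ ?x] bexI[of _ ?z]) simp_all
      next
        assume "?y \<rightarrow>\<^bsub>G\<^esub> v"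
        then show ?thesis using z ne(3) by (intro bexI[of _ ?y] bexI[of _ ?z]) simp_all
      qed
    qed
  qed
  moreover have "card {?x, ?y, ?z} = 3" using ne by simp
  ultimately show ?thesis by blast
qed

section \<open>Pairwise intersecting intervals: the value four\<close>

text \<open>Connectedness gives \<open>vs ! j\<close> a neighbour; as none lies in \<open>K\<close>,
  it lies in \<open>J\<close>.\<close>

lemma parts_ex_two:
  assumes "parts J K" "S = verts G" "Digraph_Component.connected G" "2 \<le> card (verts G)"
    and "j \<in> J" "\<And>k. k \<in> K \<Longrightarrow> \<not> vs ! j \<rightarrow>\<^bsub>G\<^esub> vs ! k"
  shows "\<exists>i \<in> J. i \<noteq> j"
proof -
  have "vs ! j \<in> verts G" using parts_nth_in[OF assms(1,5)] assms(2) by simp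
  then obtain w where w: "w \<noteq> vs ! j" "vs ! j \<rightarrow>\<^bsub>G\<^esub> w"
    using connected_ex_neighbour[OF graph_axioms assms(3,4)] by blast
  then have "w \<in> S" using graph_adj_in_verts[OF graph_axioms] assms(2) by blast
  then consider i where "i \<in> J" "w = vs ! i" | k where "k \<in> K" "w = vs ! k"
    using S_eq_parts[OF assms(1)] by blast
  then show ?thesis
  proof cases
    case (1 i) then show ?thesis using w(1) by auto
  next
    case (2 k) then show ?thesis using w(2) assms(6) by simp
  qed
qed

lemma closed_nbhd_subset_part:
  assumes "parts J K" "S = verts G" "j \<in> J" "\<And>k. k \<in> K \<Longrightarrow> \<not> vs ! j \<rightarrow>\<^bsub>G\<^esub> vs ! k"
  shows "closed_nbhd G (vs ! j) \<subseteq> (!) vs ` J"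
  using assms S_eq_parts[OF assms(1)] by (auto simp: closed_nbhd_def)

text \<open>Each clique has a vertex with no neighbour in the other. These two vertices force two
  elements of every dominating set into each clique, and any two vertices from each clique
  suffice.\<close>

lemma tuple_domination_number_intersecting:
  assumes S: "S = verts G" and conn: "Digraph_Component.connected G" and two: "2 \<le> card (verts G)"
    and "independence_number (with_proj (H1 (G \<restriction> S) vs)) < 2"
    and "independence_number (with_proj (H2 (G \<restriction> S) vs)) < 2"
  shows "tuple_domination_number 2 G = 4"
proof -
  have "S \<noteq> {}" using two S by auto
  note ne = parts_nonempty[OF parts12 this] parts_nonempty[OF parts21 this]
  \<comment> \<open>The roles cross: a common point of the intervals of \<open>part1\<close> is a
    vertex of \<open>part2\<close> without neighbours in \<open>part1\<close>, and conversely for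
    \<open>j\<close>.\<close>
  obtain k where k: "k \<in> part2" "\<And>j. j \<in> part1 \<Longrightarrow> \<not> vs ! k \<rightarrow>\<^bsub>G\<^esub> vs ! j"
    using pairwise_intersecting_common_zero[OF parts12 ne(1)] assms(4) by (auto simp: H1_def)
  obtain j where j: "j \<in> part1" "\<And>k. k \<in> part2 \<Longrightarrow> \<not> vs ! j \<rightarrow>\<^bsub>G\<^esub> vs ! k"
    using pairwise_intersecting_common_zero[OF parts21 ne(2)] assms(5) by (auto simp: H2_def)
  obtain i where i: "i \<in> part1" "i \<noteq> j" using parts_ex_two[OF parts12 S conn two j] by blast
  obtain l where l: "l \<in> part2" "l \<noteq> k" using parts_ex_two[OF parts21 S conn two k] by blast
  let ?A = "(!) vs ` part1" and ?B = "(!) vs ` part2"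
  let ?D = "{vs ! i, vs ! j, vs ! k, vs ! l}"
  have ne: "vs ! i \<noteq> vs ! j" "vs ! l \<noteq> vs ! k"
    using i j l k parts_nth_inj[OF parts12] parts_nth_inj[OF parts21] by auto
  have disj: "?A \<inter> ?B = {}" using parts_nth_disjoint[OF parts12] .
  show ?thesis
  proof (rule tuple_domination_number_eqI)
    show "finite (verts G)" by simp
    show "tuple_dominating 2 G ?D"
    proof (rule tuple_dominating_twoI[OF graph_axioms])
      show "?D \<subseteq> verts G"
        using i j k l S parts_nth_in[OF parts12] parts_nth_in[OF parts21] by auto
      fix v assume "v \<in> verts G"
      then consider m where "m \<in> part1" "v = vs ! m" | m where "m \<in> part2" "v = vs ! m"
        using S_eq_parts[OF parts12] S by blast
      then show "\<exists>x \<in> ?D. \<exists>y \<in> ?D. x \<noteq> y \<and> (x = v \<or> x \<rightarrow>\<^bsub>G\<^esub> v) \<and> (y = v \<or> y \<rightarrow>\<^bsub>G\<^esub> v)"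
      proof cases
        case (1 m)
        then have "vs ! i = v \<or> vs ! i \<rightarrow>\<^bsub>G\<^esub> v" "vs ! j = v \<or> vs ! j \<rightarrow>\<^bsub>G\<^esub> v"
          using parts_clique_refl[OF parts12] i(1) j(1) by blast+
        then show ?thesis using ne by blast
      next
        case (2 m)
        then have "vs ! l = v \<or> vs ! l \<rightarrow>\<^bsub>G\<^esub> v" "vs ! k = v \<or> vs ! k \<rightarrow>\<^bsub>G\<^esub> v"
          using parts_clique_refl[OF parts21] l(1) k(1) by blast+
        then show ?thesis using ne by blast
      qed
    qed
    have "vs ! i \<noteq> vs ! k" "vs ! i \<noteq> vs ! l" "vs ! j \<noteq> vs ! k" "vs ! j \<noteq> vs ! l"
      using disj i(1) j(1) k(1) l(1) by blast+
    then show "card ?D = 4" using ne by auto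
    fix E assume E: "tuple_dominating 2 G E"
    then have fin: "finite E" by (auto simp: tuple_dominating_def intro: finite_subset)
    \<comment> \<open>The closed neighbourhood of \<open>vs ! j\<close> stays inside
      \<open>?A\<close>, and likewise that of \<open>vs ! k\<close> inside \<open>?B\<close>; since
      \<open>?A\<close> and \<open>?B\<close> are disjoint, the two counts add up.\<close>
    have "2 \<le> card (E \<inter> ?A)"
      using parts_nth_in[OF parts12 j(1)] S closed_nbhd_subset_part[OF parts12 S j]
      by (intro tuple_dominating_two_meets_twice[OF fin E]) auto
    moreover have "2 \<le> card (E \<inter> ?B)"
      using parts_nth_in[OF parts21 k(1)] S closed_nbhd_subset_part[OF parts21 S k]
      by (intro tuple_dominating_two_meets_twice[OF fin E]) auto
    moreover have "card (E \<inter> ?A) + card (E \<inter> ?B) = card ((E \<inter> ?A) \<union> (E \<inter> ?B))"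
      using fin disj by (intro card_Un_disjoint[symmetric]) auto
    moreover have "\<dots> \<le> card E" using fin by (intro card_mono) auto
    ultimately show "4 \<le> card E" by linarith
  qed
qed

end

section \<open>The four cases, by universal vertices and independence numbers\<close>

theorem theorem4p7:
  fixes G :: "('a, 'b) pre_digraph" and U :: "'a set"
  assumes "graph G"
    and "Digraph_Component.connected G"
    and "2 \<le> card (verts G)"
    and "co_biconvex G"
    and "U = universal_vertices G"
  shows "(card U = 1 \<longrightarrow> tuple_domination_number 2 G = 3) \<and>
         (2 \<le> card U \<longrightarrow> tuple_domination_number 2 G = 2) \<and>
         (\<forall>vs \<alpha>\<^sub>1 \<alpha>\<^sub>2.
            clique_ordering (G \<restriction> (verts G - U)) vs \<and>
            \<alpha>\<^sub>1 = independence_number (with_proj (H1 (G \<restriction> (verts G - U)) vs)) \<and>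
            \<alpha>\<^sub>2 = independence_number (with_proj (H2 (G \<restriction> (verts G - U)) vs)) \<longrightarrow>
            (card U = 0 \<and> 3 \<le> \<alpha>\<^sub>1 + \<alpha>\<^sub>2 \<longrightarrow> tuple_domination_number 2 G = 3) \<and>
            (card U = 0 \<and> \<alpha>\<^sub>1 = 1 \<and> \<alpha>\<^sub>2 = 1 \<longrightarrow> tuple_domination_number 2 G = 4))"
proof -
  interpret graph G by fact
  let ?H = "G \<restriction> (verts G - U)"
  have ne: "verts G \<noteq> {}" using assms(3) by auto
  have U: "U \<subseteq> verts G" "finite U"
    using assms(5) by (auto simp: universal_vertices_def intro: finite_subset)
  have lower: "2 \<le> card E" "card U < 2 \<Longrightarrow> 3 \<le> card E" if E: "tuple_dominating 2 G E" for E
  proof -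
    show "2 \<le> card E" using tuple_dominating_card_ge[OF _ ne E] by simp
    moreover have "card E \<le> card U" if "card E \<le> 2"
      \<comment> \<open>A dominating set of size at most 2 lies inside \<open>U\<close>, so it
        cannot reach size 2 when \<open>U\<close> has fewer than two elements.\<close>
      using tuple_dominating_tight_subset_universal[OF assms(1) E that] U(2) assms(5)
      by (simp add: card_mono)
    ultimately show "3 \<le> card E" if "card U < 2" using that by linarith
  qed
  have three: "tuple_domination_number 2 G = 3"
    if "\<exists>D. tuple_dominating 2 G D \<and> card D = 3" "card U < 2"
    using that tuple_domination_number_eqI[OF finite_verts] lower(2) by blast
  have one: "tuple_domination_number 2 G = 3" if "card U = 1"
  proof (rule three)
    obtain u where u: "U = {u}" using \<open>card U = 1\<close> card_1_singletonE by blast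
    \<comment> \<open>This case mentions no ordering; one exists, and it supplies the two cliques
      covering the vertices other than \<open>u\<close>.\<close>
    obtain vs where "clique_ordering ?H vs"
      using ex_clique_ordering_non_universal[OF assms(1,4)] assms(5) by blast
    then interpret clique_ordered G "verts G - U" vs by unfold_locales auto
    have "verts G - U \<noteq> {}" using card_mono[of U "verts G"] U assms(3) that by auto
    then show "\<exists>D. tuple_dominating 2 G D \<and> card D = 3"
      using u U assms(5) by (intro dominating_universal[of u]) auto
  qed (use that in simp)
  have two: "tuple_domination_number 2 G = 2" if card: "2 \<le> card U"
  proof -
    \<comment> \<open>Any two universal vertices lie in every closed neighbourhood.\<close>
    obtain D where D: "D \<subseteq> U" "card D = 2" using card obtain_subset_with_card_n by metis
    then obtain x y where xy: "D = {x, y}" "x \<noteq> y" by (auto simp: card_2_iff)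
    have "tuple_dominating 2 G D"
    proof (rule tuple_dominating_twoI[OF assms(1)])
      show "D \<subseteq> verts G" using D U by blast
      fix v assume "v \<in> verts G"
      then have "x = v \<or> x \<rightarrow>\<^bsub>G\<^esub> v" "y = v \<or> y \<rightarrow>\<^bsub>G\<^esub> v"
        using D xy assms(5) by (auto simp: universal_vertices_def)
      then show "\<exists>x \<in> D. \<exists>y \<in> D. x \<noteq> y \<and> (x = v \<or> x \<rightarrow>\<^bsub>G\<^esub> v) \<and> (y = v \<or> y \<rightarrow>\<^bsub>G\<^esub> v)"
        using xy by blast
    qed
    then show ?thesis using D(2) lower(1) by (intro tuple_domination_number_eqI) auto
  qed
  have no_universal:
    "(3 \<le> independence_number (with_proj (H1 ?H vs)) + independence_number (with_proj (H2 ?H vs)) \<longrightarrow>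
        tuple_domination_number 2 G = 3) \<and>
     (independence_number (with_proj (H1 ?H vs)) = 1 \<and> independence_number (with_proj (H2 ?H vs)) = 1 \<longrightarrow>
        tuple_domination_number 2 G = 4)"
    if ord: "clique_ordering ?H vs" and card: "card U = 0" for vs
  proof -
    \<comment> \<open>Since \<open>card\<close> is 0 for infinite sets too, the finiteness of
      \<open>U\<close> is what makes it empty.\<close>
    have S: "verts G - U = verts G" using card U by simp
    interpret clique_ordered G "verts G - U" vs using ord by unfold_locales auto
    have Sne: "verts G - U \<noteq> {}" using S ne by simp
    show ?thesis
    proof (intro conjI impI)
      assume "3 \<le> independence_number (with_proj (H1 ?H vs)) + independence_number (with_proj (H2 ?H vs))"
      \<comment> \<open>A sum of at least 3 forces one summand to be at least 2; that clique then
        contributes the pair.\<close>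
      then consider "2 \<le> independence_number (with_proj (H1 ?H vs))"
        | "2 \<le> independence_number (with_proj (H2 ?H vs))" by linarith
      then have "\<exists>D. tuple_dominating 2 G D \<and> card D = 3"
        using dominating_disjoint_intervals[OF parts12 S Sne] dominating_disjoint_intervals[OF parts21 S Sne]
        unfolding H1_def H2_def by cases blast+
      then show "tuple_domination_number 2 G = 3" using three card by simp
    next
      assume "independence_number (with_proj (H1 ?H vs)) = 1 \<and> independence_number (with_proj (H2 ?H vs)) = 1"
      then show "tuple_domination_number 2 G = 4"
        using tuple_domination_number_intersecting[OF S assms(2,3)] by simp
    qed
  qed
  show ?thesis
  proof (intro conjI allI impI)
    fix vs \<alpha>\<^sub>1 \<alpha>\<^sub>2
    assume H: "clique_ordering ?H vs \<and> \<alpha>\<^sub>1 = independence_number (with_proj (H1 ?H vs)) \<and>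
      \<alpha>\<^sub>2 = independence_number (with_proj (H2 ?H vs))"
    show "tuple_domination_number 2 G = 3" if "card U = 0 \<and> 3 \<le> \<alpha>\<^sub>1 + \<alpha>\<^sub>2"
      using no_universal[of vs] H that by simp
    show "tuple_domination_number 2 G = 4" if "card U = 0 \<and> \<alpha>\<^sub>1 = 1 \<and> \<alpha>\<^sub>2 = 1"
      using no_universal[of vs] H that by simp
  qed (use one two in simp_all)
qed

end
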